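(* Fix a positive integer $m$ and let $n\in\mathbb{N}_0$. For every pair of compositions $(\alpha|\beta)$ with $|\alpha|+|\beta|=n$, the following identity holds in the ring $\Gamma^{(m)}$: \[h_\alpha e_\beta=\sum c^{(m)}_{\beta;(\xi,m\mu)}\, h_\lambda e_{m\mu},\] where the sum runs over all pairs of partitions $(\lambda|m\mu)$ (i.e. $\lambda,\mu$ are partitions) with $|\lambda|+m|\mu|=n$ such that $\lambda=\alpha\cup\xi$ for some (necessarily unique) partition $\xi$.
   Context: $\mathbb{N}$ denotes the positive integers and $\mathbb{N}_0$ the non-negative integers. Compositions and partitions. A composition of $n\in\mathbb{N}_0$ is a finite sequence $\lambda=(\lambda_1,\ldots,\lambda_r)$ of positive integers with sum $n$; write $|\lambda|=n$, $\ell(\lambda)=r$; the unique composition of $0$ is $\varnothing$, with $\ell(\varnothing)=0$. It is a partition if $\lambda_1\ge\cdots\ge\lambda_r$. $\mathscr{P}$ is the set of all partitions. A composition $\delta$ has type $\lambda$ ($\lambda$ a partition) if its parts can be rearranged to $\lambda$. For $m\in\mathbb{N}$, $m\mu=(m\mu_1,\ldots,m\mu_s)$. For compositions $\delta,\xi$, $\delta\cup\xi$ is the partition obtained by rearranging the concatenation of $\delta$ and $\xi$; similarly for several compositions (the empty union is $\varnothing$). When a non-negative integer $a$ is used in a union $\cup$, it means the composition $(a)$ if $a>0$ and $\varnothing$ if $a=0$. The ring $\Gamma^{(m)}$. Let $X=\{x_i:i\in\mathbb{N}\}$ and $Y=\{y_j:j\in\mathbb{N}\}$ be two independent countably infinite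 sets of commuting variables, and let $\Lambda(X),\Lambda(Y)$ be the rings of symmetric functions over $\mathbb{Z}$ in $X$, $Y$. Let $h_n(X)$ be the $n$th complete symmetric function in $X$ and $e_n(Y)$ the $n$th elementary symmetric function in $Y$, with $h_0(X)=1=e_0(Y)$. Let $\langle\Lambda(X),\Lambda(Y)\rangle$ be the subring of the power series ring in $X\cup Y$ generated by $\Lambda(X)$ and $\Lambda(Y)$; it is the polynomial ring over $\mathbb{Z}$ in $\{h_i(X),e_j(Y):i,j\in\mathbb{N}\}$. Put $\Gamma^{(m)}=\langle\Lambda(X),\Lambda(Y)\rangle/I$, where $I$ is the ideal generated by $\sum_{i=0}^d(-1)^ih_i(X)e_{d-i}(Y)$ for all positive integers $d$ with $m\nmid d$. Write $h_i=h_i(X)+I$, $e_j=e_j(Y)+I$, and for compositions $\alpha,\beta$ write $h_\alpha=\prod_i h_{\alpha_i}$, $e_\beta=\prod_j e_{\beta_j}$, with $h_\varnothing=e_\varnothing=1$. The coefficients. For a partition $\lambda$, let $c^{(m)}_\lambda$ be the number of compositions $\delta=(\delta_1,\ldots,\delta_{\ell(\lambda)})$ of type $\lambda$ such that $\delta_1+\cdots+\delta_j\not\equiv 0\pmod m$ for all $1\le j\le\ell(\lambda)$ (with $c^{(m)}_\varnothing=1$), and let $\varepsilon_\lambda=(-1)^{|\lambda|-\ell(\lambda)}$ (with $\varepsilon_\varnothing=1$). For a finite sequence $A=(\delta^{(1)},\ldots,\delta^{(r)})$ of partitions, put $c^{(m)}_A=\prod_i c^{(m)}_{\delta^{(i)}}$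 and $\varepsilon_A=\prod_i\varepsilon_{\delta^{(i)}}$. For $a\in\mathbb{N}_0$ let $\mathscr{P}(a;m)=\{\nu\in\mathscr{P}: a=|\nu|+tm\text{ for some }t\in\mathbb{N}_0\}$. For a composition $\beta$ with $s=\ell(\beta)$ and partitions $\xi,\mu$, let $V(\beta;(\xi,m\mu))$ be the set of $s$-tuples $(\xi^{(1)},\ldots,\xi^{(s)})\in\mathscr{P}(\beta_1;m)\times\cdots\times\mathscr{P}(\beta_s;m)$ such that $\xi=\xi^{(1)}\cup\cdots\cup\xi^{(s)}$ and $m\mu=(\beta_1-|\xi^{(1)}|)\cup\cdots\cup(\beta_s-|\xi^{(s)}|)$. Finally \[c^{(m)}_{\beta;(\xi,m\mu)}=\sum_{A\in V(\beta;(\xi,m\mu))}\varepsilon_A c^{(m)}_A,\] which is $0$ if $V(\beta;(\xi,m\mu))=\emptyset$. *)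

theory Defs
  imports
    "HOL-Library.Multiset"
    "HOL-Combinatorics.Permutations"
    "HOL-Algebra.Generated_Rings"
    "HOL-Algebra.QuotRing"
    "HOL-Algebra.Algebraic_Closure_Type"
begin

section \<open>Compositions and partitions\<close>

text \<open>For a composition \<^term>\<open>d :: nat list\<close>, the size is \<^term>\<open>sum_list d\<close> and the
  number of parts is \<^term>\<open>length d\<close>; the composition of 0 is \<^term>\<open>[] :: nat list\<close>.\<close>

definition is_composition :: "nat list \<Rightarrow> bool" where
  "is_composition d \<longleftrightarrow> (\<forall>p \<in> set d. 0 < p)"

definition is_partition :: "nat list \<Rightarrow> bool" where
  "is_partition l \<longleftrightarrow> is_composition l \<and> sorted_wrt (\<ge>) l"

definition has_type :: "nat list \<Rightarrow> nat list \<Rightarrow> bool" where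
  "has_type d l \<longleftrightarrow> is_composition d \<and> mset d = mset l"

definition scale :: "nat \<Rightarrow> nat list \<Rightarrow> nat list" where
  "scale m mu = map (\<lambda>p. m * p) mu"

definition Cup :: "nat list list \<Rightarrow> nat list" where
  "Cup ds = rev (sort (concat ds))"

abbreviation cup :: "nat list \<Rightarrow> nat list \<Rightarrow> nat list"  (infixl "\<union>\<^sub>p" 65) where
  "d \<union>\<^sub>p x \<equiv> Cup [d, x]"

definition nat_comp :: "nat \<Rightarrow> nat list" where
  "nat_comp a = (if 0 < a then [a] else [])"

section \<open>Power series in arbitrarily many variables\<close>

text \<open>Monomials are finite multisets of variables.\<close>

typedef 'v pseries = "UNIV :: ('v multiset \<Rightarrow> int) set"
  morphisms coeff Abs_pseries
  by simp

setup_lifting type_definition_pseries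

lemma pseries_eqI: "(\<And>M. coeff f M = coeff g M) \<Longrightarrow> f = g"
  by (simp add: coeff_inject[symmetric] fun_eq_iff)

lemma finite_mset_splits: "finite {(A, B). A + B = (M :: 'v multiset)}"
proof -
  have "finite {A. A \<subseteq># M}" for M :: "'v multiset"
  proof (induction M)
    case empty
    then show ?case by simp
  next
    case (add a M)
    have "{A. A \<subseteq># add_mset a M} \<subseteq> {A. A \<subseteq># M} \<union> add_mset a ` {A. A \<subseteq># M}"
    proof
      fix A assume A: "A \<in> {A. A \<subseteq># add_mset a M}"
      show "A \<in> {A. A \<subseteq># M} \<union> add_mset a ` {A. A \<subseteq># M}"
      proof (cases "a \<in># A")
        case True
        then obtain B where "A = add_mset a B" by (meson mset_add)
        with A show ?thesis by auto
      next
        case False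
        have "count A v \<le> count M v" for v
          using A False mset_subset_eq_count[of A "add_mset a M" v]
          by (cases "v = a") (simp_all add: not_in_iff)
        then show ?thesis by (simp add: mset_subset_eqI)
      qed
    qed
    with add show ?case by (meson finite_UnI finite_imageI finite_subset)
  qed
  from this[of M] have "finite ((\<lambda>A. (A, M - A)) ` {A. A \<subseteq># M})" by simp
  moreover have "{(A, B). A + B = M} \<subseteq> (\<lambda>A. (A, M - A)) ` {A. A \<subseteq># M}" by auto
  ultimately show ?thesis by (rule finite_subset[rotated])
qed

instantiation pseries :: (type) comm_ring_1
begin

lift_definition zero_pseries :: "'a pseries" is "\<lambda>_. 0" .
lift_definition one_pseries :: "'a pseries" is "\<lambda>M. if M = {#} then 1 else 0" .
lift_definition plus_pseries :: "'a pseries \<Rightarrow> 'a pseries \<Rightarrow> 'a pseries"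
  is "\<lambda>f g M. f M + g M" .
lift_definition minus_pseries :: "'a pseries \<Rightarrow> 'a pseries \<Rightarrow> 'a pseries"
  is "\<lambda>f g M. f M - g M" .
lift_definition uminus_pseries :: "'a pseries \<Rightarrow> 'a pseries" is "\<lambda>f M. - f M" .
lift_definition times_pseries :: "'a pseries \<Rightarrow> 'a pseries \<Rightarrow> 'a pseries"
  is "\<lambda>f g M. \<Sum>(A, B) \<in> {(A, B). A + B = M}. f A * g B" .

instance
proof
  fix f g k :: "'a pseries"
  show "f + g + k = f + (g + k)" by transfer (simp add: fun_eq_iff)
  show "f + g = g + f" by transfer (simp add: fun_eq_iff)
  show "0 + f = f" by transfer simp
  show "- f + f = 0" by transfer simp
  show "f - g = f + - g" by transfer simp
  show "(0 :: 'a pseries) \<noteq> 1" by transfer (auto simp: fun_eq_iff)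
  show "(f + g) * k = f * k + g * k"
    by transfer (simp add: fun_eq_iff sum.distrib[symmetric] algebra_simps case_prod_unfold)
  show "f * g = g * f"
  proof (transfer, rule ext)
    fix f g :: "'a multiset \<Rightarrow> int" and M
    show "(\<Sum>(A, B) \<in> {(A, B). A + B = M}. f A * g B) = (\<Sum>(A, B) \<in> {(A, B). A + B = M}. g A * f B)"
      by (rule sum.reindex_bij_witness[of _ prod.swap prod.swap]) (auto simp: add.commute)
  qed
  show "1 * f = f"
  proof (transfer, rule ext)
    fix f :: "'a multiset \<Rightarrow> int" and M
    have "(\<Sum>(A, B) \<in> {(A, B). A + B = M}. (if A = {#} then 1 else 0) * f B)
        = (\<Sum>(A, B) \<in> {({#} :: 'a multiset, M)}. (if A = {#} then 1 else 0) * f B)"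
      by (intro sum.mono_neutral_right finite_mset_splits) (auto split: if_splits)
    then show "(\<Sum>(A, B) \<in> {(A, B). A + B = M}. (if A = {#} then 1 else 0) * f B) = f M"
      by simp
  qed
  show "f * g * k = f * (g * k)"
  proof (transfer, rule ext)
    fix f g k :: "'a multiset \<Rightarrow> int" and M
    let ?S = "\<lambda>M. {(A, B). A + B = (M :: 'a multiset)}"
    have "(\<Sum>(A, B) \<in> ?S M. (\<Sum>(C, D) \<in> ?S A. f C * g D) * k B)
        = (\<Sum>p \<in> ?S M. \<Sum>q \<in> ?S (fst p). f (fst q) * g (snd q) * k (snd p))"
      by (simp add: sum_distrib_right case_prod_unfold)
    also have "\<dots> = (\<Sum>(p, q) \<in> Sigma (?S M) (\<lambda>p. ?S (fst p)). f (fst q) * g (snd q) * k (snd p))"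
      by (rule sum.Sigma) (auto simp: finite_mset_splits)
    also have "\<dots> = (\<Sum>(p, q) \<in> Sigma (?S M) (\<lambda>p. ?S (snd p)). f (fst p) * g (fst q) * k (snd q))"
      by (rule sum.reindex_bij_witness[of _
            "\<lambda>(p, q). ((fst p + fst q, snd q), (fst p, fst q))"
            "\<lambda>(p, q). ((fst q, snd q + snd p), (snd q, snd p))"])
         (auto simp: add.assoc)
    also have "\<dots> = (\<Sum>p \<in> ?S M. \<Sum>q \<in> ?S (snd p). f (fst p) * g (fst q) * k (snd q))"
      by (rule sum.Sigma[symmetric]) (auto simp: finite_mset_splits)
    also have "\<dots> = (\<Sum>(A, B) \<in> ?S M. f A * (\<Sum>(C, D) \<in> ?S B. g C * k D))"
      by (simp add: sum_distrib_left case_prod_unfold mult.assoc)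
    finally show "(\<Sum>(A, B) \<in> ?S M. (\<Sum>(C, D) \<in> ?S A. f C * g D) * k B)
        = (\<Sum>(A, B) \<in> ?S M. f A * (\<Sum>(C, D) \<in> ?S B. g C * k D))" .
  qed
qed

end

section \<open>Symmetric functions\<close>

text \<open>Symmetric functions over the integers in the variables \<^term>\<open>Z\<close>: power series of
  bounded degree involving only variables in \<^term>\<open>Z\<close> and invariant under all permutations
  of \<^term>\<open>Z\<close>.\<close>

definition sym_functions :: "'v set \<Rightarrow> 'v pseries set" where
  "sym_functions Z = {f.
     (\<exists>d. \<forall>M. coeff f M \<noteq> 0 \<longrightarrow> size M \<le> d) \<and>
     (\<forall>M. coeff f M \<noteq> 0 \<longrightarrow> set_mset M \<subseteq> Z) \<and>
     (\<forall>\<pi> M. \<pi> permutes Z \<longrightarrow> coeff f (image_mset \<pi> M) = coeff f M)}"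

text \<open>The sum of all monomials of degree \<^term>\<open>n\<close>, and of all squarefree ones, in \<^term>\<open>Z\<close>.\<close>

definition complete_sym :: "'v set \<Rightarrow> nat \<Rightarrow> 'v pseries" where
  "complete_sym Z n = Abs_pseries (\<lambda>M. if size M = n \<and> set_mset M \<subseteq> Z then 1 else 0)"

definition elementary_sym :: "'v set \<Rightarrow> nat \<Rightarrow> 'v pseries" where
  "elementary_sym Z n = Abs_pseries
     (\<lambda>M. if size M = n \<and> set_mset M \<subseteq> Z \<and> (\<forall>v. count M v \<le> 1) then 1 else 0)"

section \<open>The ring \<open>\<Gamma>\<^sup>(\<^sup>m\<^sup>)\<close>\<close>

text \<open>The variables are indexed from 0: \<^term>\<open>Inl i\<close> and \<^term>\<open>Inr j\<close> stand for
  \<open>x\<close> with index \<open>i + 1\<close> and \<open>y\<close> with index \<open>j + 1\<close>.\<close>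

type_synonym var = "nat + nat"

definition Xvars :: "var set" where "Xvars = range Inl"
definition Yvars :: "var set" where "Yvars = range Inr"

definition LamXY :: "var pseries ring" where
  "LamXY = (ring_of_type_algebra :: var pseries ring)
     \<lparr>carrier := generate_ring ring_of_type_algebra (sym_functions Xvars \<union> sym_functions Yvars)\<rparr>"

definition relator :: "nat \<Rightarrow> var pseries" where
  "relator d = (\<Sum>i = 0..d. (-1) ^ i * complete_sym Xvars i * elementary_sym Yvars (d - i))"

definition I_ideal :: "nat \<Rightarrow> var pseries set" where
  "I_ideal m = Idl\<^bsub>LamXY\<^esub> {relator d | d. 0 < d \<and> \<not> m dvd d}"

definition \<Gamma> :: "nat \<Rightarrow> var pseries set ring" where
  "\<Gamma> m = LamXY Quot I_ideal m"

definition h :: "nat \<Rightarrow> nat \<Rightarrow> var pseries set" where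
  "h m i = I_ideal m +>\<^bsub>LamXY\<^esub> complete_sym Xvars i"

definition e :: "nat \<Rightarrow> nat \<Rightarrow> var pseries set" where
  "e m j = I_ideal m +>\<^bsub>LamXY\<^esub> elementary_sym Yvars j"

definition h_comp :: "nat \<Rightarrow> nat list \<Rightarrow> var pseries set" where
  "h_comp m a = (\<Otimes>\<^bsub>\<Gamma> m\<^esub> i \<in> {..<length a}. h m (a ! i))"

definition e_comp :: "nat \<Rightarrow> nat list \<Rightarrow> var pseries set" where
  "e_comp m b = (\<Otimes>\<^bsub>\<Gamma> m\<^esub> j \<in> {..<length b}. e m (b ! j))"

section \<open>The coefficients\<close>

definition c_part :: "nat \<Rightarrow> nat list \<Rightarrow> nat" where
  "c_part m l = card {d. has_type d l \<and>
     (\<forall>j \<in> {1..length l}. \<not> m dvd sum_list (take j d))}"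

text \<open>The subtractions on \<^typ>\<open>nat\<close> in this section never truncate: the parts of a partition are
  positive, and its size is at most \<open>a\<close> if it lies in \<open>Parts a m\<close>.\<close>

definition sign_part :: "nat list \<Rightarrow> int" where
  "sign_part l = (-1) ^ (sum_list l - length l)"

definition c_seq :: "nat \<Rightarrow> nat list list \<Rightarrow> nat" where
  "c_seq m A = (\<Prod>l\<leftarrow>A. c_part m l)"

definition sign_seq :: "nat list list \<Rightarrow> int" where
  "sign_seq A = (\<Prod>l\<leftarrow>A. sign_part l)"

definition Parts :: "nat \<Rightarrow> nat \<Rightarrow> nat list set" where
  "Parts a m = {nu. is_partition nu \<and> (\<exists>t. a = sum_list nu + t * m)}"

text \<open>In \<open>V\<close> and \<open>coef\<close> the last argument is the partition written \<open>m\<mu>\<close>, not \<open>\<mu>\<close>.\<close>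

definition V :: "nat \<Rightarrow> nat list \<Rightarrow> nat list \<Rightarrow> nat list \<Rightarrow> nat list list set" where
  "V m b x mmu = {A. length A = length b \<and>
     (\<forall>i < length b. A ! i \<in> Parts (b ! i) m) \<and>
     x = Cup A \<and>
     mmu = Cup (map (\<lambda>i. nat_comp (b ! i - sum_list (A ! i))) [0..<length b])}"

definition coef :: "nat \<Rightarrow> nat list \<Rightarrow> nat list \<Rightarrow> nat list \<Rightarrow> int" where
  "coef m b x mmu = (\<Sum>A \<in> V m b x mmu. sign_seq A * int (c_seq m A))"

section \<open>Well-definedness of the sums\<close>

lemma finite_compositions_le: "finite {d. is_composition d \<and> sum_list d \<le> n}"
proof -
  have "length d \<le> sum_list d" if "is_composition d" for d
    using that by (induction d) (auto simp: is_composition_def)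
  then have "{d. is_composition d \<and> sum_list d \<le> n} \<subseteq> {d. set d \<subseteq> {..n} \<and> length d \<le> n}"
    by (auto dest: member_le_sum_list intro: order_trans)
  then show ?thesis
    by (rule finite_subset) (simp add: finite_lists_length_le)
qed

lemma finite_V: "finite (V m b x mmu)"
proof -
  let ?U = "{d. is_composition d \<and> sum_list d \<le> sum_list b}"
  have "V m b x mmu \<subseteq> {A. set A \<subseteq> ?U \<and> length A = length b}"
  proof
    fix A assume A: "A \<in> V m b x mmu"
    have "A ! i \<in> ?U" if "i < length b" for i
    proof -
      from A that have "A ! i \<in> Parts (b ! i) m" by (simp add: V_def)
      then have "is_composition (A ! i)" "sum_list (A ! i) \<le> b ! i"
        by (auto simp: Parts_def is_partition_def)
      moreover have "b ! i \<le> sum_list b" using that by (simp add: elem_le_sum_list)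
      ultimately show ?thesis by simp
    qed
    with A show "A \<in> {A. set A \<subseteq> ?U \<and> length A = length b}"
      by (auto simp: V_def in_set_conv_nth)
  qed
  then show ?thesis
    by (rule finite_subset) (intro finite_lists_length_eq finite_compositions_le)
qed

lemma finite_partition_pairs:
  assumes "0 < m"
  shows "finite {(l, mu). is_partition l \<and> is_partition mu \<and> sum_list l + m * sum_list mu = n}"
proof (rule finite_subset)
  let ?U = "{d. is_composition d \<and> sum_list d \<le> n}"
  have "sum_list mu \<le> m * sum_list mu" for mu :: "nat list" using assms by simp
  from trans_le_add2[OF this] show "{(l, mu). is_partition l \<and> is_partition mu \<and> sum_list l + m * sum_list mu = n}
      \<subseteq> ?U \<times> ?U"
    by (auto simp: is_partition_def)
  show "finite (?U \<times> ?U)" by (intro finite_cartesian_product finite_compositions_le)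
qed

lemma cup_right_unique:
  assumes "is_partition x" "is_partition y" "a \<union>\<^sub>p x = a \<union>\<^sub>p y"
  shows "x = y"
proof -
  from assms(3) have "mset (a \<union>\<^sub>p x) = mset (a \<union>\<^sub>p y)" by simp
  then have "mset (rev x) = mset (rev y)" by (simp add: Cup_def)
  moreover have "sorted (rev x)" "sorted (rev y)"
    using assms(1,2) by (auto simp: is_partition_def sorted_wrt_rev)
  ultimately have "rev x = rev y" by (metis properties_for_sort)
  then show ?thesis by simp
qed

end

theory Submission
  imports Defs
begin

text \<open>For \<open>m \<nmid> b\<close> the defining relation of degree \<open>b\<close> reads
  \<open>e\<^sub>b = (\<Sum>i = 1..b. (-1)\<^sup>i\<^sup>-\<^sup>1 h\<^sub>i e\<^sub>b\<^sub>-\<^sub>i)\<close>. Applying it again to every \<open>e\<^sub>b\<^sub>-\<^sub>i\<close> with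
  \<open>m \<nmid> b - i\<close> and so on, the process stops exactly at indices divisible by \<open>m\<close>. It yields
  \<open>e\<^sub>b = (\<Sum>d. (-1)\<^bsup>|d| - \<ell>(d)\<^esup> h\<^sub>d e\<^bsub>b - |d|\<^esub>)\<close> over the compositions \<open>d\<close> with \<open>|d| \<le> b\<close>,
  \<open>|d| \<equiv> b (mod m)\<close> and no partial sum divisible by \<open>m\<close>, the parts of \<open>d\<close> being removed from
  last to first. Sorting the \<open>d\<close> by type produces the numbers \<open>c\<^sub>\<nu>\<close>; multiplying over the parts
  of \<open>\<beta>\<close> and collecting equal monomials gives the coefficients of the theorem.\<close>

section \<open>Arithmetic modulo an ideal of a subring\<close>

text \<open>\<open>C\<close> and \<open>I\<close> are plain sets in a type-class ring, so
  \<open>sum\<close>, \<open>prod_list\<close> and \<open>algebra_simps\<close> apply; congruence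
  modulo \<open>I\<close> is membership of a difference.\<close>

locale subring_ideal =
  fixes C I :: "'a::comm_ring_1 set"
  assumes one_closed: "1 \<in> C"
    and diff_closed: "x \<in> C \<Longrightarrow> y \<in> C \<Longrightarrow> x - y \<in> C"
    and mult_closed: "x \<in> C \<Longrightarrow> y \<in> C \<Longrightarrow> x * y \<in> C"
    and ideal_zero: "0 \<in> I"
    and ideal_add: "x \<in> I \<Longrightarrow> y \<in> I \<Longrightarrow> x + y \<in> I"
    and ideal_mult: "x \<in> C \<Longrightarrow> y \<in> I \<Longrightarrow> x * y \<in> I"
begin

lemma zero_closed: "0 \<in> C"
  using diff_closed[OF one_closed one_closed] by simp

lemma uminus_closed: "x \<in> C \<Longrightarrow> - x \<in> C"
  using diff_closed[OF zero_closed] by fastforce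

lemma add_closed: "x \<in> C \<Longrightarrow> y \<in> C \<Longrightarrow> x + y \<in> C"
  using diff_closed[OF _ uminus_closed] by fastforce

lemma sum_closed: "(\<And>x. x \<in> A \<Longrightarrow> f x \<in> C) \<Longrightarrow> sum f A \<in> C"
  by (induction A rule: infinite_finite_induct) (auto intro: zero_closed add_closed)

lemma prod_list_closed: "(\<And>x. x \<in> set xs \<Longrightarrow> f x \<in> C) \<Longrightarrow> (\<Prod>x\<leftarrow>xs. f x) \<in> C"
  by (induction xs) (auto intro: one_closed mult_closed)

lemma of_nat_closed: "of_nat k \<in> C"
  by (induction k) (auto intro: zero_closed one_closed add_closed)

lemma of_int_closed: "of_int k \<in> C"
  by (cases k) (auto intro: of_nat_closed uminus_closed simp del: of_nat_Suc)

lemma minus_one_power_closed: "(-1) ^ k \<in> C"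
  using of_int_closed[of "(-1) ^ k"] by simp

lemma ideal_sum: "(\<And>x. x \<in> A \<Longrightarrow> f x \<in> I) \<Longrightarrow> sum f A \<in> I"
  by (induction A rule: infinite_finite_induct) (auto intro: ideal_zero ideal_add)

text \<open>Congruences can be multiplied: the induction replaces one factor at a time.\<close>

lemma ideal_prod_list_diff:
  assumes "\<And>x. x \<in> set xs \<Longrightarrow> f x - g x \<in> I"
    and "\<And>x. x \<in> set xs \<Longrightarrow> f x \<in> C" "\<And>x. x \<in> set xs \<Longrightarrow> g x \<in> C"
  shows "(\<Prod>x\<leftarrow>xs. f x) - (\<Prod>x\<leftarrow>xs. g x) \<in> I"
  using assms
proof (induction xs)
  case Nil
  then show ?case by (simp add: ideal_zero)
next
  case (Cons a xs)
  let ?F = "\<Prod>x\<leftarrow>xs. f x" and ?G = "\<Prod>x\<leftarrow>xs. g x"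
  have "f a * (?F - ?G) + ?G * (f a - g a) \<in> I"
    using Cons by (intro ideal_add ideal_mult prod_list_closed) auto
  also have "f a * (?F - ?G) + ?G * (f a - g a) = f a * ?F - g a * ?G"
    by (simp add: algebra_simps)
  finally show ?case by simp
qed

end

section \<open>The expansion of a single elementary symmetric function\<close>

text \<open>One element for each way of running the reduction from index \<open>b\<close> until it
  halts, which happens at the index \<open>b - sum_list d\<close>.\<close>

definition residue_comps :: "nat \<Rightarrow> nat \<Rightarrow> nat list set" where
  "residue_comps m b = {d. is_composition d \<and> sum_list d \<le> b \<and> m dvd b - sum_list d \<and>
     (\<forall>j \<in> {1..length d}. \<not> m dvd sum_list (take j d))}"

lemma finite_residue_comps: "finite (residue_comps m b)"
  by (rule finite_subset[OF _ finite_compositions_le[of b]]) (auto simp: residue_comps_def)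

lemma length_le_sum_list: "is_composition d \<Longrightarrow> length d \<le> sum_list d"
  by (induction d) (auto simp: is_composition_def)

text \<open>As \<open>m\<close> divides both \<open>b\<close> and \<open>b - sum_list d\<close>, it
  divides \<open>sum_list d\<close>, which is the last partial sum of a nonempty
  \<open>d\<close>.\<close>

lemma residue_comps_dvd:
  assumes "m dvd b"
  shows "residue_comps m b = {[]}"
proof (intro equalityI subsetI)
  fix d assume d: "d \<in> residue_comps m b"
  then have "m dvd sum_list d"
    using assms by (metis (no_types, lifting) residue_comps_def mem_Collect_eq dvd_diffD1)
  moreover have "length d \<in> {1..length d}" if "d \<noteq> []"
    using that by (cases d) auto
  ultimately show "d \<in> {[]}"
    using d by (force simp: residue_comps_def)
qed (use assms in \<open>simp add: residue_comps_def is_composition_def\<close>)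

text \<open>Splitting off the last part \<open>i\<close> keeps the final index
  \<open>b - sum_list d\<close> and loses only the full partial sum, whose indivisibility follows
  from that of \<open>b\<close>.\<close>

lemma residue_comps_not_dvd:
  assumes "\<not> m dvd b"
  shows "residue_comps m b = (\<Union>i\<in>{1..b}. (\<lambda>d. d @ [i]) ` residue_comps m (b - i))"
proof (intro equalityI subsetI)
  fix d assume d: "d \<in> residue_comps m b"
  with assms have "d \<noteq> []" by (auto simp: residue_comps_def)
  then obtain d' i where di: "d = d' @ [i]" by (metis rev_exhaust)
  have "\<not> m dvd sum_list (take j d')" if "j \<in> {1..length d'}" for j
    using d that unfolding residue_comps_def di
    by (auto dest!: bspec[of _ _ j])
  with d have "i \<in> {1..b}" "d' \<in> residue_comps m (b - i)"
    by (auto simp: residue_comps_def di is_composition_def add.commute)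
  with di show "d \<in> (\<Union>i\<in>{1..b}. (\<lambda>d. d @ [i]) ` residue_comps m (b - i))" by auto
next
  fix d assume "d \<in> (\<Union>i\<in>{1..b}. (\<lambda>d. d @ [i]) ` residue_comps m (b - i))"
  then obtain i d' where i: "i \<in> {1..b}" and d': "d' \<in> residue_comps m (b - i)"
    and d: "d = d' @ [i]" by auto
  have le: "sum_list d \<le> b" and dvd: "m dvd b - sum_list d"
    using i d' by (auto simp: residue_comps_def d add.commute)
  with assms have "\<not> m dvd sum_list d" by (metis dvd_diffD)
  then have "\<not> m dvd sum_list (take j d)" if "j \<in> {1..length d}" for j
    using that d' by (cases "j = length d") (auto simp: residue_comps_def d)
  with le dvd i d' show "d \<in> residue_comps m b"
    by (auto simp: residue_comps_def d is_composition_def)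
qed

text \<open>For \<open>nu\<close> in \<open>Parts b m\<close> every rearrangement satisfies the size
  conditions of \<open>residue_comps\<close>, and \<open>nu\<close> is the only weakly decreasing
  one.\<close>

lemma c_part_eq_card:
  assumes "nu \<in> Parts b m"
  shows "c_part m nu = card {d \<in> residue_comps m b. rev (sort d) = nu}"
proof -
  have "has_type d nu \<and> (\<forall>j \<in> {1..length nu}. \<not> m dvd sum_list (take j d)) \<longleftrightarrow>
      d \<in> residue_comps m b \<and> rev (sort d) = nu" for d
  proof -
    have "mset d = mset nu \<longleftrightarrow> rev (sort d) = nu"
    proof
      assume "mset d = mset nu"
      then have "mset (rev nu) = mset d" by simp
      moreover have "sorted (rev nu)"
        using assms by (simp add: Parts_def is_partition_def sorted_wrt_rev)
      ultimately have "sort d = rev nu" by (metis properties_for_sort)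
      then show "rev (sort d) = nu" by simp
    qed auto
    moreover have "length d = length nu" "sum_list d = sum_list nu" if "mset d = mset nu"
      using that by (metis size_mset, metis sum_mset_sum_list)
    ultimately show ?thesis
      using assms by (auto simp: has_type_def residue_comps_def Parts_def)
  qed
  then show ?thesis by (simp add: c_part_def)
qed

lemma residue_comps_partition:
  assumes "d \<in> residue_comps m b"
  shows "rev (sort d) \<in> Parts b m"
proof -
  have sum: "sum_list (rev (sort d)) = sum_list d"
    by (metis mset_rev mset_sort sum_mset_sum_list)
  obtain t where "b - sum_list d = m * t"
    using assms by (auto simp: residue_comps_def)
  moreover have "sum_list d \<le> b"
    using assms by (simp add: residue_comps_def)
  ultimately have "b = sum_list d + t * m"
    by (metis le_add_diff_inverse mult.commute)
  with sum show ?thesis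
    using assms by (auto simp: residue_comps_def Parts_def is_partition_def is_composition_def
        sorted_wrt_rev)
qed

lemma finite_Parts: "finite (Parts b m)"
  by (rule finite_subset[OF _ finite_compositions_le[of b]]) (auto simp: Parts_def is_partition_def)

text \<open>The hypothesis says that \<open>F\<close> depends only on the type of \<open>d\<close>;
  the fibre over the type \<open>nu\<close> has \<open>c_part m nu\<close> elements.\<close>

lemma sum_residue_comps_by_type:
  fixes F :: "nat list \<Rightarrow> 'a::comm_ring_1"
  assumes "\<And>d. F (rev (sort d)) = F d"
  shows "(\<Sum>d\<in>residue_comps m b. F d) = (\<Sum>nu\<in>Parts b m. of_nat (c_part m nu) * F nu)"
proof -
  have "(\<Sum>d\<in>residue_comps m b. F d) =
      (\<Sum>nu\<in>Parts b m. \<Sum>d\<in>{d \<in> residue_comps m b. rev (sort d) = nu}. F d)"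
    by (rule sum.group[symmetric]) (auto simp: finite_residue_comps finite_Parts residue_comps_partition)
  also have "\<dots> = (\<Sum>nu\<in>Parts b m. of_nat (c_part m nu) * F nu)"
  proof (rule sum.cong[OF refl])
    fix nu assume "nu \<in> Parts b m"
    have "(\<Sum>d\<in>{d \<in> residue_comps m b. rev (sort d) = nu}. F d) =
        (\<Sum>d\<in>{d \<in> residue_comps m b. rev (sort d) = nu}. F nu)"
      using assms by (intro sum.cong) auto
    then show "(\<Sum>d\<in>{d \<in> residue_comps m b. rev (sort d) = nu}. F d) = of_nat (c_part m nu) * F nu"
      using \<open>nu \<in> Parts b m\<close> by (simp add: c_part_eq_card)
  qed
  finally show ?thesis .
qed

lemma prod_list_mset_eq:
  fixes f :: "'b \<Rightarrow> 'a::comm_monoid_mult"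
  shows "mset xs = mset ys \<Longrightarrow> (\<Prod>x\<leftarrow>xs. f x) = (\<Prod>x\<leftarrow>ys. f x)"
  by (metis mset_map prod_mset_prod_list)

section \<open>Reduction of \<open>E b\<close> by the relations\<close>

text \<open>Only the values in degree zero and the relations are recorded, so no property of
  symmetric functions enters the expansion.\<close>

locale he_relations = subring_ideal C I
  for C I :: "'a::comm_ring_1 set" +
  fixes m :: nat and H E :: "nat \<Rightarrow> 'a"
  assumes H_closed: "H i \<in> C" and E_closed: "E j \<in> C"
    and H_0: "H 0 = 1" and E_0: "E 0 = 1"
    and relation: "0 < d \<Longrightarrow> \<not> m dvd d \<Longrightarrow> (\<Sum>i=0..d. (-1) ^ i * H i * E (d - i)) \<in> I"
begin

lemma prod_H_closed: "(\<Prod>i\<leftarrow>d. H i) \<in> C" and prod_E_closed: "(\<Prod>i\<leftarrow>d. E i) \<in> C"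
  by (auto intro: prod_list_closed H_closed E_closed)

text \<open>Strong induction on \<open>b\<close>. If \<open>m\<close> divides \<open>b\<close>, the
  sum is \<open>E b\<close> itself; otherwise the relation of degree \<open>b\<close> expresses
  \<open>E b\<close> through the \<open>E (b - i)\<close> with \<open>i\<close> at least 1.\<close>

lemma E_cong_residue_comps:
  "E b - (\<Sum>d\<in>residue_comps m b.
     (-1) ^ (sum_list d - length d) * (\<Prod>i\<leftarrow>d. H i) * E (b - sum_list d)) \<in> I"
proof (induction b rule: less_induct)
  case (less b)
  \<comment> \<open>The index is an argument of \<open>T\<close> because the induction hypotheses
    concern the summands for \<open>b - i\<close>.\<close>
  define T where "T b d = (-1) ^ (sum_list d - length d) * (\<Prod>i\<leftarrow>d. H i) * E (b - sum_list d)" for b d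
  show ?case
  proof (cases "m dvd b")
    case True
    then show ?thesis by (simp add: residue_comps_dvd ideal_zero)
  next
    case False
    then have b: "0 < b" by (cases b) auto
    \<comment> \<open>The pieces are disjoint because their last parts differ.\<close>
    have "(\<Sum>d\<in>residue_comps m b. T b d) =
        (\<Sum>i\<in>{1..b}. \<Sum>d\<in>(\<lambda>d. d @ [i]) ` residue_comps m (b - i). T b d)"
      unfolding residue_comps_not_dvd[OF False]
      by (rule sum.UNION_disjoint) (auto simp: finite_residue_comps)
    also have "\<dots> = (\<Sum>i\<in>{1..b}. (-1) ^ (i - 1) * H i * (\<Sum>d\<in>residue_comps m (b - i). T (b - i) d))"
    proof (rule sum.cong[OF refl])
      fix i assume i: "i \<in> {1..b}"
      have "T b (d @ [i]) = (-1) ^ (i - 1) * H i * T (b - i) d" if "d \<in> residue_comps m (b - i)" for d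
      proof -
        \<comment> \<open>This keeps the subtraction in the exponent from truncating, so appending
          \<open>i\<close> multiplies the sign by \<open>(-1) ^ (i - 1)\<close>.\<close>
        have "length d \<le> sum_list d"
          using that by (intro length_le_sum_list) (simp add: residue_comps_def)
        then have "sum_list d + i - Suc (length d) = (sum_list d - length d) + (i - 1)"
          using i by simp
        then show ?thesis
          by (simp add: T_def power_add algebra_simps)
      qed
      then show "(\<Sum>d\<in>(\<lambda>d. d @ [i]) ` residue_comps m (b - i). T b d) =
          (-1) ^ (i - 1) * H i * (\<Sum>d\<in>residue_comps m (b - i). T (b - i) d)"
        by (subst sum.reindex) (auto simp: inj_on_def sum_distrib_left)
    qed
    finally have 1: "(\<Sum>d\<in>residue_comps m b. T b d) =
      (\<Sum>i\<in>{1..b}. (-1) ^ (i - 1) * H i * (\<Sum>d\<in>residue_comps m (b - i). T (b - i) d))" .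
    have 2: "(\<Sum>i=0..b. (-1) ^ i * H i * E (b - i)) =
        E b - (\<Sum>i\<in>{1..b}. (-1) ^ (i - 1) * H i * E (b - i))"
    proof -
      have "(\<Sum>i=0..b. (-1) ^ i * H i * E (b - i)) =
          E b + (\<Sum>i=Suc 0..b. (-1) ^ i * H i * E (b - i))"
        by (subst sum.atLeast_Suc_atMost) (auto simp: H_0)
      also have "(\<Sum>i=Suc 0..b. (-1) ^ i * H i * E (b - i)) =
          (\<Sum>i=Suc 0..b. - ((-1) ^ (i - 1) * H i * E (b - i)))"
      proof (rule sum.cong[OF refl])
        fix i assume "i \<in> {Suc 0..b}"
        then obtain k where "i = Suc k" by (cases i) auto
        then show "(-1) ^ i * H i * E (b - i) = - ((-1) ^ (i - 1) * H i * E (b - i))" by simp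
      qed
      finally show ?thesis by (simp add: sum_negf)
    qed
    \<comment> \<open>The relation is added to the weighted induction hypotheses; the terms in
      \<open>E (b - i)\<close> with \<open>i\<close> at least 1 cancel.\<close>
    have "(\<Sum>i=0..b. (-1) ^ i * H i * E (b - i)) +
      (\<Sum>i\<in>{1..b}. (-1) ^ (i - 1) * H i * (E (b - i) - (\<Sum>d\<in>residue_comps m (b - i). T (b - i) d))) \<in> I"
      using less False b unfolding T_def
      by (intro ideal_add relation ideal_sum ideal_mult mult_closed minus_one_power_closed H_closed)
        (auto simp del: diff_diff_left)
    also have "(\<Sum>i=0..b. (-1) ^ i * H i * E (b - i)) +
      (\<Sum>i\<in>{1..b}. (-1) ^ (i - 1) * H i * (E (b - i) - (\<Sum>d\<in>residue_comps m (b - i). T (b - i) d)))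
      = E b - (\<Sum>d\<in>residue_comps m b. T b d)"
      unfolding 1 2 right_diff_distrib sum_subtractf by simp
    finally show ?thesis by (simp add: T_def)
  qed
qed

definition expansion_term :: "nat \<Rightarrow> nat list \<Rightarrow> 'a" where
  "expansion_term b nu =
    of_int (sign_part nu * int (c_part m nu)) * (\<Prod>i\<leftarrow>nu. H i) * E (b - sum_list nu)"

lemma expansion_term_closed: "expansion_term b nu \<in> C"
  unfolding expansion_term_def by (intro mult_closed of_int_closed prod_H_closed E_closed)

text \<open>Sign, product of the \<open>H i\<close> and remaining index depend only on the multiset
  of parts, so compositions can be collected by type.\<close>

lemma E_cong_Parts: "E b - (\<Sum>nu\<in>Parts b m. expansion_term b nu) \<in> I"
proof -
  define F where "F d = (-1) ^ (sum_list d - length d) * (\<Prod>i\<leftarrow>d. H i) * E (b - sum_list d)" for d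
  have "F (rev (sort d)) = F d" for d
  proof -
    have "sum_list (rev (sort d)) = sum_list d"
      by (metis mset_rev mset_sort sum_mset_sum_list)
    moreover have "(\<Prod>i\<leftarrow>rev (sort d). H i) = (\<Prod>i\<leftarrow>d. H i)"
      by (intro prod_list_mset_eq) simp
    ultimately show ?thesis by (simp add: F_def)
  qed
  then have "(\<Sum>d\<in>residue_comps m b. F d) = (\<Sum>nu\<in>Parts b m. of_nat (c_part m nu) * F nu)"
    by (rule sum_residue_comps_by_type)
  also have "\<dots> = (\<Sum>nu\<in>Parts b m. expansion_term b nu)"
    by (intro sum.cong) (simp_all add: F_def expansion_term_def sign_part_def algebra_simps)
  finally show ?thesis
    using E_cong_residue_comps[of b] by (simp add: F_def)
qed

end

section \<open>Products and collection of terms\<close>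

text \<open>Expanding the product means choosing one summand per factor; \<open>list_all2\<close>
  lets the range of a choice depend on its factor.\<close>

lemma prod_list_sum_distrib:
  fixes f :: "'b \<Rightarrow> 'c \<Rightarrow> 'a::comm_ring_1"
  assumes "\<And>b. finite (S b)"
  shows "(\<Prod>b\<leftarrow>bs. \<Sum>s\<in>S b. f b s) =
    (\<Sum>A\<in>{A. list_all2 (\<lambda>b s. s \<in> S b) bs A}. \<Prod>(b, s)\<leftarrow>zip bs A. f b s)"
proof (induction bs)
  case Nil
  then show ?case by simp
next
  case (Cons b bs)
  let ?W = "\<lambda>bs. {A. list_all2 (\<lambda>b s. s \<in> S b) bs A}"
  have W: "?W (b # bs) = (\<lambda>(s, A). s # A) ` (S b \<times> ?W bs)"
    by (auto simp: list_all2_Cons1)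
  have "(\<Sum>A\<in>?W (b # bs). \<Prod>(b, s)\<leftarrow>zip (b # bs) A. f b s) =
      (\<Sum>(s, A)\<in>S b \<times> ?W bs. f b s * (\<Prod>(b, s)\<leftarrow>zip bs A. f b s))"
    unfolding W by (subst sum.reindex) (auto simp: inj_on_def case_prod_unfold)
  also have "\<dots> = (\<Sum>s\<in>S b. f b s) * (\<Sum>A\<in>?W bs. \<Prod>(b, s)\<leftarrow>zip bs A. f b s)"
    by (simp add: sum_product sum.cartesian_product)
  finally show ?case using Cons by simp
qed

section \<open>Unions of partitions and the remainders of a tuple\<close>

lemma set_Cup: "set (Cup ds) = (\<Union>d\<in>set ds. set d)"
  by (simp add: Cup_def)

lemma sum_list_Cup: "sum_list (Cup ds) = (\<Sum>d\<leftarrow>ds. sum_list d)"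
proof -
  have "sum_list (Cup ds) = sum_list (concat ds)"
    by (metis Cup_def mset_rev mset_sort sum_mset_sum_list)
  also have "\<dots> = (\<Sum>d\<leftarrow>ds. sum_list d)"
    by (induction ds) auto
  finally show ?thesis .
qed

lemma prod_list_Cup:
  fixes f :: "nat \<Rightarrow> 'a::comm_monoid_mult"
  shows "(\<Prod>i\<leftarrow>Cup ds. f i) = (\<Prod>d\<leftarrow>ds. \<Prod>i\<leftarrow>d. f i)"
proof -
  have "(\<Prod>i\<leftarrow>Cup ds. f i) = (\<Prod>i\<leftarrow>concat ds. f i)"
    by (rule prod_list_mset_eq) (simp add: Cup_def)
  also have "\<dots> = (\<Prod>d\<leftarrow>ds. \<Prod>i\<leftarrow>d. f i)"
    by (induction ds) auto
  finally show ?thesis .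
qed

lemma sorted_Cup: "sorted_wrt (\<ge>) (Cup ds)"
  by (simp add: Cup_def sorted_wrt_rev)

lemma is_partition_Cup: "(\<And>d. d \<in> set ds \<Longrightarrow> is_composition d) \<Longrightarrow> is_partition (Cup ds)"
  by (auto simp: is_partition_def sorted_Cup is_composition_def set_Cup)

lemma sum_list_scale: "sum_list (scale m mu) = m * sum_list mu"
  by (simp add: scale_def sum_list_const_mult)

lemma sum_list_nat_comp [simp]: "sum_list (nat_comp a) = a"
  by (simp add: nat_comp_def)

text \<open>The partition that \<open>V\<close> requires \<open>mmu\<close> to equal, written with
  \<open>zip\<close> to suit induction along both lists.\<close>

definition remainders :: "nat list \<Rightarrow> nat list list \<Rightarrow> nat list" where
  "remainders bs A = Cup (map (\<lambda>(b, nu). nat_comp (b - sum_list nu)) (zip bs A))"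

text \<open>Tuples with both unions left free; the sets \<open>V m bs x mmu\<close> are the fibres
  of the pair of unions.\<close>

definition part_tuples :: "nat \<Rightarrow> nat list \<Rightarrow> nat list list set" where
  "part_tuples m bs = {A. list_all2 (\<lambda>b nu. nu \<in> Parts b m) bs A}"

lemma V_altdef: "V m bs x mmu = {A \<in> part_tuples m bs. x = Cup A \<and> mmu = remainders bs A}"
proof -
  have "map (\<lambda>i. nat_comp (bs ! i - sum_list (A ! i))) [0..<length bs] =
      map (\<lambda>(b, nu). nat_comp (b - sum_list nu)) (zip bs A)" if "length A = length bs" for A
    using that by (intro nth_equalityI) auto
  then show ?thesis
    by (auto simp: V_def part_tuples_def remainders_def list_all2_conv_all_nth)
qed

lemma finite_part_tuples: "finite (part_tuples m bs)"
proof (induction bs)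
  case (Cons b bs)
  have "part_tuples m (b # bs) = (\<lambda>(s, A). s # A) ` (Parts b m \<times> part_tuples m bs)"
    by (auto simp: part_tuples_def list_all2_Cons1)
  with Cons show ?case by (simp add: finite_Parts)
qed (simp add: part_tuples_def)

lemma part_tuples_is_composition:
  assumes "A \<in> part_tuples m bs" "nu \<in> set A"
  shows "is_composition nu"
  using assms
  by (auto simp: part_tuples_def list_all2_conv_all_nth in_set_conv_nth Parts_def is_partition_def)

text \<open>From \<open>b = sum_list nu + t * m\<close> the difference is \<open>t * m\<close>, and
  \<open>nat_comp\<close> drops it when it is zero.\<close>

lemma remainders_dvd:
  assumes "A \<in> part_tuples m bs" "p \<in> set (remainders bs A)"
  shows "0 < p" "m dvd p"
  using assms
  by (auto simp: part_tuples_def remainders_def set_Cup list_all2_iff nat_comp_def Parts_def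
      split: if_splits dest!: bspec)

lemma scale_div_remainders:
  assumes "A \<in> part_tuples m bs"
  shows "scale m (map (\<lambda>p. p div m) (remainders bs A)) = remainders bs A"
  unfolding scale_def map_map
  by (rule map_idI) (use remainders_dvd[OF assms] in auto)

text \<open>Division by \<open>m\<close> preserves the order, and a positive multiple of
  \<open>m\<close> has a positive quotient.\<close>

lemma is_partition_div_remainders:
  assumes "0 < m" "A \<in> part_tuples m bs"
  shows "is_partition (map (\<lambda>p. p div m) (remainders bs A))"
proof -
  have "sorted_wrt (\<ge>) (remainders bs A)"
    by (simp add: remainders_def sorted_Cup)
  then have "sorted_wrt (\<lambda>p q. q div m \<le> p div m) (remainders bs A)"
    by (rule sorted_wrt_mono_rel[rotated]) (simp add: div_le_mono)
  then show ?thesis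
    using remainders_dvd[OF assms(2)] assms(1)
    by (auto simp: is_partition_def is_composition_def sorted_wrt_map div_greater_zero_iff dvd_imp_le)
qed

lemma sum_list_remainders:
  assumes "A \<in> part_tuples m bs"
  shows "sum_list (Cup A) + sum_list (remainders bs A) = sum_list bs"
proof -
  have "list_all2 (\<lambda>b nu. nu \<in> Parts b m) bs A"
    using assms by (simp add: part_tuples_def)
  then show ?thesis
    unfolding remainders_def sum_list_Cup
    by (induction rule: list_all2_induct) (auto simp: Parts_def)
qed

lemma scale_eq_iff: "0 < m \<Longrightarrow> scale m mu = scale m mu' \<longleftrightarrow> mu = mu'"
  unfolding scale_def by (rule inj_map_eq_map) (simp add: inj_on_def)

section \<open>Expansion of products and collection by monomials\<close>

context he_relations
begin

text \<open>Induction along both lists; a zero remainder is absent from \<open>remainders\<close>,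
  in accordance with \<open>E 0 = 1\<close>.\<close>

lemma prod_expansion_term:
  assumes "A \<in> part_tuples m bs"
  shows "(\<Prod>(b, nu)\<leftarrow>zip bs A. expansion_term b nu) =
    of_int (sign_seq A * int (c_seq m A)) * (\<Prod>i\<leftarrow>Cup A. H i) * (\<Prod>i\<leftarrow>remainders bs A. E i)"
proof -
  have "list_all2 (\<lambda>b nu. nu \<in> Parts b m) bs A"
    using assms by (simp add: part_tuples_def)
  then show ?thesis
    unfolding remainders_def prod_list_Cup
    by (induction rule: list_all2_induct)
       (simp_all add: sign_seq_def c_seq_def expansion_term_def nat_comp_def E_0 algebra_simps)
qed

lemma prod_E_cong:
  "(\<Prod>b\<leftarrow>bs. E b) - (\<Sum>A\<in>part_tuples m bs. of_int (sign_seq A * int (c_seq m A)) *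
      (\<Prod>i\<leftarrow>Cup A. H i) * (\<Prod>i\<leftarrow>remainders bs A. E i)) \<in> I"
proof -
  have "(\<Prod>b\<leftarrow>bs. E b) - (\<Prod>b\<leftarrow>bs. \<Sum>nu\<in>Parts b m. expansion_term b nu) \<in> I"
    by (intro ideal_prod_list_diff E_cong_Parts E_closed sum_closed expansion_term_closed)
  then show ?thesis
    by (simp add: prod_list_sum_distrib finite_Parts prod_expansion_term flip: part_tuples_def)
qed

text \<open>Collecting tuples by the pair \<open>(x, mu)\<close> that they determine produces
  \<open>coef\<close>; adjoining \<open>a\<close> then turns \<open>x\<close> into
  \<open>lam\<close> injectively.\<close>

lemma prod_H_prod_E_cong:
  assumes m: "0 < m" and a: "is_composition a"
    and n: "sum_list a + sum_list b = n"
  shows "(\<Prod>i\<leftarrow>a. H i) * (\<Prod>j\<leftarrow>b. E j) -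
    (\<Sum>(lam, mu)\<in>{(lam, mu). is_partition lam \<and> is_partition mu \<and>
        sum_list lam + m * sum_list mu = n \<and> (\<exists>x. is_partition x \<and> lam = a \<union>\<^sub>p x)}.
      of_int (coef m b (THE x. is_partition x \<and> lam = a \<union>\<^sub>p x) (scale m mu)) *
        ((\<Prod>i\<leftarrow>lam. H i) * (\<Prod>j\<leftarrow>scale m mu. E j))) \<in> I"
proof -
  let ?T = "{(lam, mu). is_partition lam \<and> is_partition mu \<and>
        sum_list lam + m * sum_list mu = n \<and> (\<exists>x. is_partition x \<and> lam = a \<union>\<^sub>p x)}"
  \<comment> \<open>The index pairs for \<open>b\<close> alone, before \<open>a\<close> is
    adjoined.\<close>
  define S where "S = {(x, mu). is_partition x \<and> is_partition mu \<and>
        sum_list x + m * sum_list mu = sum_list b}"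
  define term_of where "term_of A = of_int (sign_seq A * int (c_seq m A)) *
      (\<Prod>i\<leftarrow>Cup A. H i) * (\<Prod>i\<leftarrow>remainders b A. E i)" for A
  \<comment> \<open>\<open>g\<close> records exactly what the monomial of \<open>A\<close> depends
    on.\<close>
  define g where "g A = (Cup A, map (\<lambda>p. p div m) (remainders b A))" for A
  have fin: "finite S"
    unfolding S_def by (rule finite_partition_pairs[OF m])
  have g: "g ` part_tuples m b \<subseteq> S"
  proof (intro image_subsetI)
    fix A assume A: "A \<in> part_tuples m b"
    have "m * sum_list (map (\<lambda>p. p div m) (remainders b A)) = sum_list (remainders b A)"
      by (metis A scale_div_remainders sum_list_scale)
    then show "g A \<in> S"
      using A m sum_list_remainders[OF A]
      by (simp add: S_def g_def is_partition_Cup part_tuples_is_composition is_partition_div_remainders)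
  qed
  have fibre: "{A \<in> part_tuples m b. g A = (x, mu)} = V m b x (scale m mu)" for x mu
  proof -
    have "map (\<lambda>p. p div m) (remainders b A) = mu \<longleftrightarrow> scale m mu = remainders b A"
      if "A \<in> part_tuples m b" for A
      using scale_div_remainders[OF that] scale_eq_iff[OF m] by metis
    then show ?thesis by (auto simp: V_altdef g_def)
  qed
  \<comment> \<open>Pairs in \<open>S\<close> outside the image of \<open>g\<close> contribute empty
    sums.\<close>
  have "(\<Sum>A\<in>part_tuples m b. term_of A) =
      (\<Sum>(x, mu)\<in>S. \<Sum>A\<in>V m b x (scale m mu). term_of A)"
    by (subst sum.group[OF finite_part_tuples fin g, symmetric])
       (auto intro!: sum.cong simp flip: fibre)
  \<comment> \<open>Within one \<open>V\<close> the monomial is constant, so only the coefficients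
    add up.\<close>
  also have "\<dots> = (\<Sum>(x, mu)\<in>S. of_int (coef m b x (scale m mu)) *
      ((\<Prod>i\<leftarrow>x. H i) * (\<Prod>j\<leftarrow>scale m mu. E j)))"
    by (intro sum.cong refl)
       (auto simp: coef_def term_of_def sum_distrib_right V_altdef mult.assoc intro!: sum.cong)
  finally have expand: "(\<Sum>A\<in>part_tuples m b. term_of A) = \<dots>" .

  have T: "?T = (\<lambda>(x, mu). (a \<union>\<^sub>p x, mu)) ` S"
  proof -
    have "is_partition (a \<union>\<^sub>p x)" if "is_partition x" for x
      using that a by (intro is_partition_Cup) (auto simp: is_partition_def)
    with n show ?thesis
      by (auto simp: S_def sum_list_Cup image_iff)
  qed
  have inj: "inj_on (\<lambda>(x, mu). (a \<union>\<^sub>p x, mu)) S"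
    by (auto simp: inj_on_def S_def dest: cup_right_unique)
  \<comment> \<open>Cancellation of \<open>a\<close> makes the definite description return
    \<open>x\<close>.\<close>
  have the: "(THE x'. is_partition x' \<and> a \<union>\<^sub>p x = a \<union>\<^sub>p x') = x" if "(x, mu) \<in> S" for x mu
    using that by (intro the_equality) (auto simp: S_def dest: cup_right_unique)
  have "(\<Prod>i\<leftarrow>a. H i) * (\<Sum>A\<in>part_tuples m b. term_of A) =
      (\<Sum>(lam, mu)\<in>?T. of_int (coef m b (THE x. is_partition x \<and> lam = a \<union>\<^sub>p x) (scale m mu)) *
        ((\<Prod>i\<leftarrow>lam. H i) * (\<Prod>j\<leftarrow>scale m mu. E j)))"
    unfolding T sum.reindex[OF inj] expand sum_distrib_left
    by (intro sum.cong refl) (auto simp: the prod_list_Cup algebra_simps)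
  moreover have "(\<Prod>i\<leftarrow>a. H i) * ((\<Prod>j\<leftarrow>b. E j) - (\<Sum>A\<in>part_tuples m b. term_of A)) \<in> I"
    using prod_E_cong[of b] by (intro ideal_mult prod_H_closed) (simp add: term_of_def)
  ultimately show ?thesis
    by (simp add: right_diff_distrib)
qed

end

section \<open>Transfer to \<open>\<Gamma>\<^sup>(\<^sup>m\<^sup>)\<close>\<close>

lemma coeff_complete_sym:
  "coeff (complete_sym Z n) M = (if size M = n \<and> set_mset M \<subseteq> Z then 1 else 0)"
  by (simp add: complete_sym_def Abs_pseries_inverse)

lemma coeff_elementary_sym:
  "coeff (elementary_sym Z n) M =
    (if size M = n \<and> set_mset M \<subseteq> Z \<and> (\<forall>v. count M v \<le> 1) then 1 else 0)"
  by (simp add: elementary_sym_def Abs_pseries_inverse)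

lemma complete_sym_0: "complete_sym Z 0 = 1"
  by (rule pseries_eqI) (auto simp: coeff_complete_sym one_pseries.rep_eq)

lemma elementary_sym_0: "elementary_sym Z 0 = 1"
  by (rule pseries_eqI) (auto simp: coeff_elementary_sym one_pseries.rep_eq)

lemma complete_sym_in_sym_functions: "complete_sym Z n \<in> sym_functions Z"
  unfolding sym_functions_def
  by (auto simp: coeff_complete_sym permutes_in_image split: if_splits)

text \<open>A permutation carries multiplicities over unchanged; \<open>k = 1\<close> says that
  squarefree monomials stay squarefree.\<close>

lemma count_image_mset_permutes:
  assumes "p permutes Z"
  shows "(\<forall>v. count (image_mset p M) v \<le> k) \<longleftrightarrow> (\<forall>v. count M v \<le> k)"
proof -
  have "count (image_mset p M) (p v) = count M v" for v
  proof -
    have "p -` {p v} = {v}"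
      using inj_vimage_image_eq[OF permutes_inj[OF assms], of "{v}"] by simp
    then show ?thesis
      by (cases "v \<in># M") (auto simp: count_image_mset not_in_iff)
  qed
  then show ?thesis
    using permutes_surj[OF assms] by (metis surjD)
qed

lemma elementary_sym_in_sym_functions: "elementary_sym Z n \<in> sym_functions Z"
  unfolding sym_functions_def
  by (auto simp: coeff_elementary_sym permutes_in_image count_image_mset_permutes split: if_splits)

section \<open>The ring \<open>LamXY\<close> and its ideals\<close>

lemma ring_of_type_algebra_simps:
  "carrier ring_of_type_algebra = UNIV" "x \<otimes>\<^bsub>ring_of_type_algebra\<^esub> y = x * y"
  "x \<oplus>\<^bsub>ring_of_type_algebra\<^esub> y = x + y" "\<one>\<^bsub>ring_of_type_algebra\<^esub> = 1"
  "\<zero>\<^bsub>ring_of_type_algebra\<^esub> = 0"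
  by (simp_all add: ring_of_type_algebra_def)

lemma LamXY_simps:
  "x \<otimes>\<^bsub>LamXY\<^esub> y = x * y" "x \<oplus>\<^bsub>LamXY\<^esub> y = x + y" "\<one>\<^bsub>LamXY\<^esub> = 1" "\<zero>\<^bsub>LamXY\<^esub> = 0"
  by (simp_all add: LamXY_def ring_of_type_algebra_simps)

text \<open>Only the carrier of \<open>ring_of_type_algebra\<close> is replaced, and the generated
  set is a subring.\<close>

lemma cring_LamXY: "cring LamXY"
proof -
  let ?R = "ring_of_type_algebra :: var pseries ring"
  interpret R: cring ?R by (rule cring_from_type_algebra)
  have "subring (generate_ring ?R (sym_functions Xvars \<union> sym_functions Yvars)) ?R"
    by (rule R.generate_ring_is_subring) (simp add: ring_of_type_algebra_simps)
  then show ?thesis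
    unfolding LamXY_def using R.subcringI' R.subcring_iff subringE(1) by blast
qed

interpretation LamXY: cring LamXY
  by (rule cring_LamXY)

text \<open>Unlike the operations in \<open>LamXY_simps\<close>, the inverse is defined through the
  carrier, hence the membership hypothesis.\<close>

lemma LamXY_a_inv: "x \<in> carrier LamXY \<Longrightarrow> \<ominus>\<^bsub>LamXY\<^esub> x = - x"
  using LamXY.l_neg[of x] by (simp add: LamXY_simps eq_neg_iff_add_eq_0)

lemma LamXY_minus: "x \<in> carrier LamXY \<Longrightarrow> y \<in> carrier LamXY \<Longrightarrow> x \<ominus>\<^bsub>LamXY\<^esub> y = x - y"
  by (simp add: LamXY.minus_eq LamXY_a_inv LamXY_simps)

lemma complete_sym_carrier: "complete_sym Xvars n \<in> carrier LamXY"
  by (simp add: LamXY_def generate_ring.incl complete_sym_in_sym_functions)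

lemma elementary_sym_carrier: "elementary_sym Yvars n \<in> carrier LamXY"
  by (simp add: LamXY_def generate_ring.incl elementary_sym_in_sym_functions)

lemma LamXY_finprod: "f \<in> A \<rightarrow> carrier LamXY \<Longrightarrow> finprod LamXY f A = prod f A"
  \<comment> \<open>Both products default to 1 over an infinite index set.\<close>
  by (induction A rule: infinite_finite_induct) (auto simp: LamXY_simps)

lemma LamXY_finsum: "f \<in> A \<rightarrow> carrier LamXY \<Longrightarrow> finsum LamXY f A = sum f A"
  by (induction A rule: infinite_finite_induct) (auto simp: LamXY_simps)

lemma LamXY_add_pow_nat: "x \<in> carrier LamXY \<Longrightarrow> [(k::nat)] \<cdot>\<^bsub>LamXY\<^esub> x = of_nat k * x"
  by (induction k) (simp_all add: LamXY_simps algebra_simps)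

lemma LamXY_add_pow_int:
  assumes "x \<in> carrier LamXY"
  shows "[(k::int)] \<cdot>\<^bsub>LamXY\<^esub> x = of_int k * x"
proof (cases "0 \<le> k")
  case True
  then show ?thesis
    using assms by (simp add: add_pow_int_ge LamXY_add_pow_nat)
next
  case False
  then show ?thesis
    using assms LamXY.add.nat_pow_closed[OF assms, of "nat (- k)"]
    by (simp add: add_pow_int_lt LamXY_a_inv LamXY_add_pow_nat)
qed

lemma subring_ideal_LamXY:
  assumes "ideal J LamXY"
  shows "subring_ideal (carrier LamXY) J"
proof -
  interpret ideal J LamXY by fact
  show ?thesis
  proof
    show "x * y \<in> carrier LamXY" if "x \<in> carrier LamXY" "y \<in> carrier LamXY" for x y
      using LamXY.m_closed[OF that] by (simp add: LamXY_simps)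
    show "x - y \<in> carrier LamXY" if "x \<in> carrier LamXY" "y \<in> carrier LamXY" for x y
      using LamXY.minus_closed[OF that] by (simp add: LamXY_minus that)
    show "x + y \<in> J" if "x \<in> J" "y \<in> J" for x y
      using a_closed[OF that] by (simp add: LamXY_simps)
    show "x * y \<in> J" if "x \<in> carrier LamXY" "y \<in> J" for x y
      using I_l_closed[OF that(2,1)] by (simp add: LamXY_simps)
  qed (use LamXY.one_closed zero_closed in \<open>simp_all add: LamXY_simps\<close>)
qed

text \<open>The zero ideal gives access to the closure lemmas for the carrier before
  \<open>I_ideal m\<close> is known to be an ideal.\<close>

interpretation LamXY_sub: subring_ideal "carrier LamXY" "{0}"
  using subring_ideal_LamXY[OF LamXY.zeroideal] by (simp add: LamXY_simps)

lemma relator_carrier: "relator d \<in> carrier LamXY"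
  unfolding relator_def
  by (intro LamXY_sub.sum_closed LamXY_sub.mult_closed LamXY_sub.minus_one_power_closed
      complete_sym_carrier elementary_sym_carrier)

lemma ideal_I_ideal: "ideal (I_ideal m) LamXY"
  unfolding I_ideal_def by (rule LamXY.genideal_ideal) (auto simp: relator_carrier)

text \<open>The required relations are the generators \<open>relator d\<close> of the ideal.\<close>

lemma he_relations_I_ideal:
  "he_relations (carrier LamXY) (I_ideal m) m (complete_sym Xvars) (elementary_sym Yvars)"
proof (intro he_relations.intro he_relations_axioms.intro subring_ideal_LamXY ideal_I_ideal)
  fix d :: nat assume "0 < d" "\<not> m dvd d"
  then have "relator d \<in> I_ideal m"
    unfolding I_ideal_def
    using LamXY.genideal_self[of "{relator d | d. 0 < d \<and> \<not> m dvd d}"] relator_carrier by blast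
  then show "(\<Sum>i=0..d. (-1) ^ i * complete_sym Xvars i * elementary_sym Yvars (d - i)) \<in> I_ideal m"
    by (simp add: relator_def)
qed (simp_all add: complete_sym_carrier elementary_sym_carrier complete_sym_0 elementary_sym_0)

section \<open>The quotient map onto \<open>\<Gamma> m\<close>\<close>

definition to_Gamma :: "nat \<Rightarrow> var pseries \<Rightarrow> var pseries set" where
  "to_Gamma m x = I_ideal m +>\<^bsub>LamXY\<^esub> x"

lemma to_Gamma_hom: "ring_hom_cring LamXY (\<Gamma> m) (to_Gamma m)"
  unfolding to_Gamma_def \<Gamma>_def
  by (rule ideal.rcos_ring_hom_cring[OF ideal_I_ideal cring_LamXY])

lemma to_Gamma_eqI:
  assumes "x \<in> carrier LamXY" "y \<in> carrier LamXY" "x - y \<in> I_ideal m"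
  shows "to_Gamma m x = to_Gamma m y"
  using LamXY.quotient_eq_iff_same_a_r_cos[OF ideal_I_ideal assms(1,2)] assms
  by (simp add: to_Gamma_def LamXY_minus)

text \<open>Ring homomorphisms commute with finite products; this also turns the products over
  positions in \<open>h_comp\<close> and \<open>e_comp\<close> into products over lists.\<close>

lemma to_Gamma_prod_list:
  assumes "\<And>i. f i \<in> carrier LamXY"
  shows "(\<Otimes>\<^bsub>\<Gamma> m\<^esub> i \<in> {..<length a}. to_Gamma m (f (a ! i))) = to_Gamma m (\<Prod>i\<leftarrow>a. f i)"
proof -
  interpret ring_hom_cring LamXY "\<Gamma> m" "to_Gamma m" by (rule to_Gamma_hom)
  have "(\<Prod>i\<leftarrow>a. f i) = (\<Otimes>\<^bsub>LamXY\<^esub> i \<in> {..<length a}. f (a ! i))"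
    using assms by (simp add: LamXY_finprod Pi_def prod.list_conv_set_nth atLeast0LessThan)
  then show ?thesis
    using assms hom_finprod[of "\<lambda>i. f (a ! i)" "{..<length a}"] by (simp add: Pi_def o_def)
qed

lemma h_comp_eq_to_Gamma: "h_comp m a = to_Gamma m (\<Prod>i\<leftarrow>a. complete_sym Xvars i)"
  using to_Gamma_prod_list[of "complete_sym Xvars"] complete_sym_carrier
  by (simp add: h_comp_def h_def to_Gamma_def)

lemma e_comp_eq_to_Gamma: "e_comp m b = to_Gamma m (\<Prod>j\<leftarrow>b. elementary_sym Yvars j)"
  using to_Gamma_prod_list[of "elementary_sym Yvars"] elementary_sym_carrier
  by (simp add: e_comp_def e_def to_Gamma_def)

text \<open>The quotient map is a homomorphism of additive groups, so it commutes with integer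
  multiples.\<close>

lemma to_Gamma_add_pow:
  assumes "x \<in> carrier LamXY"
  shows "[(k::int)] \<cdot>\<^bsub>\<Gamma> m\<^esub> to_Gamma m x = to_Gamma m (of_int k * x)"
proof -
  interpret ring_hom_cring LamXY "\<Gamma> m" "to_Gamma m" by (rule to_Gamma_hom)
  interpret group_hom "add_monoid LamXY" "add_monoid (\<Gamma> m)" "to_Gamma m"
    by unfold_locales (auto simp: hom_def)
  have "to_Gamma m ([k] \<cdot>\<^bsub>LamXY\<^esub> x) = [k] \<cdot>\<^bsub>\<Gamma> m\<^esub> to_Gamma m x"
    unfolding add_pow_def using hom_int_pow assms by simp
  with assms show ?thesis by (simp add: LamXY_add_pow_int)
qed

theorem theorem4p2:
  fixes m n :: nat and \<alpha> \<beta> :: "nat list"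
  assumes "0 < m"
    and "is_composition \<alpha>" and "is_composition \<beta>"
    and "sum_list \<alpha> + sum_list \<beta> = n"
  shows "h_comp m \<alpha> \<otimes>\<^bsub>\<Gamma> m\<^esub> e_comp m \<beta> =
    finsum (\<Gamma> m)
      (\<lambda>(lam, \<mu>).
        [coef m \<beta> (THE \<xi>. is_partition \<xi> \<and> lam = \<alpha> \<union>\<^sub>p \<xi>) (scale m \<mu>)] \<cdot>\<^bsub>\<Gamma> m\<^esub>
          (h_comp m lam \<otimes>\<^bsub>\<Gamma> m\<^esub> e_comp m (scale m \<mu>)))
      {(lam, \<mu>). is_partition lam \<and> is_partition \<mu> \<and>
        sum_list lam + m * sum_list \<mu> = n \<and>
        (\<exists>\<xi>. is_partition \<xi> \<and> lam = \<alpha> \<union>\<^sub>p \<xi>)}"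
proof -
  let ?T = "{(lam, \<mu>). is_partition lam \<and> is_partition \<mu> \<and>
        sum_list lam + m * sum_list \<mu> = n \<and>
        (\<exists>\<xi>. is_partition \<xi> \<and> lam = \<alpha> \<union>\<^sub>p \<xi>)}"
  interpret ring_hom_cring LamXY "\<Gamma> m" "to_Gamma m" by (rule to_Gamma_hom)
  interpret he_relations "carrier LamXY" "I_ideal m" m "complete_sym Xvars" "elementary_sym Yvars"
    by (rule he_relations_I_ideal)
  let ?h = "\<lambda>a. \<Prod>i\<leftarrow>a. complete_sym Xvars i" and ?e = "\<lambda>b. \<Prod>j\<leftarrow>b. elementary_sym Yvars j"
  \<comment> \<open>\<open>F\<close> lifts the summand to \<open>LamXY\<close>, with the integer
    multiple as a factor.\<close>
  define F where "F = (\<lambda>(lam, \<mu>).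
    of_int (coef m \<beta> (THE \<xi>. is_partition \<xi> \<and> lam = \<alpha> \<union>\<^sub>p \<xi>) (scale m \<mu>)) *
      (?h lam * ?e (scale m \<mu>)))"
  have he_closed: "?h a * ?e b \<in> carrier LamXY" for a b
    by (intro mult_closed prod_H_closed prod_E_closed)
  have mult: "h_comp m a \<otimes>\<^bsub>\<Gamma> m\<^esub> e_comp m b = to_Gamma m (?h a * ?e b)" for a b
    unfolding h_comp_eq_to_Gamma e_comp_eq_to_Gamma
    using hom_mult[OF prod_H_closed prod_E_closed] by (simp add: LamXY_simps)
  have F_closed: "F p \<in> carrier LamXY" for p
    unfolding F_def case_prod_unfold by (intro mult_closed of_int_closed he_closed)
  \<comment> \<open>The congruence modulo \<open>I_ideal m\<close> becomes an equality of
    cosets.\<close>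
  have "h_comp m \<alpha> \<otimes>\<^bsub>\<Gamma> m\<^esub> e_comp m \<beta> = to_Gamma m (\<Sum>p\<in>?T. F p)"
    unfolding mult
    by (intro to_Gamma_eqI he_closed sum_closed F_closed)
       (use prod_H_prod_E_cong[OF assms(1,2,4)] in \<open>simp add: F_def\<close>)
  also have "\<dots> = finsum (\<Gamma> m) (\<lambda>p. to_Gamma m (F p)) ?T"
    using hom_finsum[of F ?T] F_closed by (simp add: LamXY_finsum Pi_def o_def)
  also have "(\<lambda>p. to_Gamma m (F p)) = (\<lambda>(lam, \<mu>).
        [coef m \<beta> (THE \<xi>. is_partition \<xi> \<and> lam = \<alpha> \<union>\<^sub>p \<xi>) (scale m \<mu>)] \<cdot>\<^bsub>\<Gamma> m\<^esub>
          (h_comp m lam \<otimes>\<^bsub>\<Gamma> m\<^esub> e_comp m (scale m \<mu>)))"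
    unfolding mult to_Gamma_add_pow[OF he_closed] by (simp add: F_def case_prod_unfold)
  finally show ?thesis .
qed

end
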